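(* Let $f$ be a $g$-convex function on the interval $J$ and put $h=g\circ f$. Then for all $a<b$ in $J$, $$f\left(\frac{a+b}{2}\right)\le \frac{1}{b-a}\int_a^b f(z)\,dz\le \frac{1}{b-a}\int_a^b g^{-1}\left(\frac{z-a}{b-a}h(a)+\frac{b-z}{b-a}h(b)\right)dz\le \frac{f(a)+f(b)}{2}.$$
   Context: Let $J,J_2,J_3\subseteq\mathbb{R}$ be intervals. A continuous function $f:J\to J_2$ is called $g$-convex on $J$ if $g:J_2\to J_3$ is (strictly) increasing and concave on $J_2$ and $g\circ f:J\to J_3$ is convex. $g^{-1}$ denotes the inverse of $g$, defined on $g(J_2)$. *)

theory Defs
  imports "HOL-Analysis.Analysis"
begin

(* f : J \<rightarrow> J\<^sub>2 and g : J\<^sub>2 \<rightarrow> J\<^sub>3 are total functions of which only the values on J and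
   J\<^sub>2 are constrained. No continuity of g is assumed: a concave function may be
   discontinuous at an endpoint of its interval. *)
definition g_convex_on ::
  "real set \<Rightarrow> real set \<Rightarrow> real set \<Rightarrow> (real \<Rightarrow> real) \<Rightarrow> (real \<Rightarrow> real) \<Rightarrow> bool" where
  "g_convex_on J J\<^sub>2 J\<^sub>3 g f \<longleftrightarrow>
     is_interval J \<and> is_interval J\<^sub>2 \<and> is_interval J\<^sub>3 \<and>
     continuous_on J f \<and> f ` J \<subseteq> J\<^sub>2 \<and> g ` J\<^sub>2 \<subseteq> J\<^sub>3 \<and>
     strict_mono_on J\<^sub>2 g \<and> concave_on J\<^sub>2 g \<and> convex_on J (g \<circ> f)"

end

theory Submission
  imports Defs
begin

text \<open>
  Write \<open>k z\<close> for the value of \<open>g\<inverse>\<close> in the statement. Since \<open>g\<close> is increasing and concave,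
  convexity of \<open>g \<circ> f\<close> gives that of \<open>f\<close>, and affinity of \<open>g \<circ> k\<close> gives convexity of \<open>k\<close>; the two
  outer inequalities are then the Hermite--Hadamard inequalities for \<open>f\<close> and \<open>k\<close>. The middle one
  follows from \<open>f z \<le> k (a + b - z)\<close>, as the affine function is the reflected chord of \<open>h\<close>.
  The delicate point is that \<open>k\<close> takes the values of a genuine inverse although \<open>g\<close> may jump at the
  left end of its domain. Convexity of \<open>h\<close> forces upper semicontinuity on \<open>[a, b]\<close>, concavity of \<open>g\<close>
  forces lower semicontinuity of \<open>g \<circ> f\<close>, so \<open>h\<close> is continuous and attains all the values needed.
\<close>

text \<open>With \<open>w\<close> the chord value of \<open>f\<close>, convexity of
  \<open>g \<circ> f\<close> and then concavity of \<open>g\<close> give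
  \<open>g (f z) \<le> g w\<close>. Strict monotonicity allows \<open>g\<close> to be cancelled,
  since both arguments lie in the interval \<open>T\<close>. This serves both \<open>f\<close> and
  \<open>k\<close>.\<close>

lemma convex_on_of_convex_comp:
  fixes g :: "real \<Rightarrow> real" and f :: "'a::real_vector \<Rightarrow> real"
  assumes "strict_mono_on T g" "concave_on T g" "f ` S \<subseteq> T" "convex_on S (g \<circ> f)"
  shows "convex_on S f"
proof (rule convex_onI)
  show S: "convex S"
    using assms(4) convex_on_imp_convex by blast
  fix t x y assume t: "0 < t" "t < (1::real)" and xy: "x \<in> S" "y \<in> S"
  let ?z = "(1 - t) *\<^sub>R x + t *\<^sub>R y" and ?w = "(1 - t) * f x + t * f y"
  have z: "?z \<in> S"
    using S t xy by (simp add: convex_alt)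
  have fxy: "f x \<in> T" "f y \<in> T" "f ?z \<in> T"
    using assms(3) xy z by auto
  have w: "?w \<in> T"
    using concave_on_imp_convex[OF assms(2)] t fxy unfolding convex_alt by force
  have "g (f ?z) \<le> (1 - t) * g (f x) + t * g (f y)"
    using convex_onD[OF assms(4), of t x y] t xy by simp
  also have "\<dots> \<le> g ?w"
    using concave_onD[OF assms(2), of t "f x" "f y"] t fxy by simp
  finally show "f ?z \<le> ?w"
    using strict_mono_onD[OF assms(1) w fxy(3)] by linarith
qed

text \<open>On either side of \<open>x\<close> the graph lies below the chord from \<open>x\<close>
  to the endpoint on that side. The bound is one-sided and \<open>C\<close> depends on
  \<open>x\<close>, so it survives at the endpoints, where a convex function may jump.\<close>

lemma convex_on_Icc_upper_Lipschitz_at: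
  fixes f :: "real \<Rightarrow> real"
  assumes "convex_on {a..b} f" and x: "x \<in> {a..b}"
  obtains C where "\<And>y. y \<in> {a..b} \<Longrightarrow> f y - f x \<le> C * \<bar>y - x\<bar>"
proof
  fix y assume y: "y \<in> {a..b}"
  \<comment> \<open>The slopes of the two chords. If \<open>x\<close> is an endpoint, one quotient
    is \<open>0 / 0 = 0\<close>, harmlessly: on that side there is no \<open>y\<close> other than
    \<open>x\<close>.\<close>
  let ?A = "(f b - f x) / (b - x)" and ?B = "(f a - f x) / (x - a)"
  show "f y - f x \<le> (\<bar>?A\<bar> + \<bar>?B\<bar>) * \<bar>y - x\<bar>"
  proof (cases "x \<le> y")
    case True
    have "convex_on {x..b} f"
      by (rule convex_on_subset[OF assms(1)]) (use x in auto)
    then have "f y - f x \<le> ?A * (y - x)"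
      using convex_onD_Icc'[of x b f y] y True by simp
    also have "\<dots> \<le> (\<bar>?A\<bar> + \<bar>?B\<bar>) * (y - x)"
      using True by (intro mult_right_mono) linarith+
    finally show ?thesis using True by simp
  next
    case False
    have "convex_on {a..x} f"
      by (rule convex_on_subset[OF assms(1)]) (use x in auto)
    then have "f y - f x \<le> ?B * (x - y)"
      using convex_onD_Icc''[of a x f y] y False by simp
    also have "\<dots> \<le> (\<bar>?A\<bar> + \<bar>?B\<bar>) * (x - y)"
      using False by (intro mult_right_mono) linarith+
    finally show ?thesis using False by simp
  qed
qed

lemma continuous_on_convex_comp_concave:
  fixes f g :: "real \<Rightarrow> real"
  assumes f: "continuous_on {a..b} f" and g: "concave_on (f ` {a..b}) g"
    and gf: "convex_on {a..b} (g \<circ> f)"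
  shows "continuous_on {a..b} (g \<circ> f)"
proof (cases "a \<le> b")
  case True
  then obtain u v where uv: "f ` {a..b} = {u..v}"
    using continuous_image_closed_interval[OF True f] by blast
  have ng: "convex_on {u..v} (\<lambda>w. - g w)"
    using g uv by (simp add: concave_on_def)
  show ?thesis
    unfolding continuous_on_def
  proof
    fix x assume x: "x \<in> {a..b}"
    obtain C where C: "\<And>y. y \<in> {a..b} \<Longrightarrow> (g \<circ> f) y - (g \<circ> f) x \<le> C * \<bar>y - x\<bar>"
      using convex_on_Icc_upper_Lipschitz_at[OF gf x] by blast
    have "f x \<in> {u..v}" using x uv by blast
    then obtain D where D: "\<And>w. w \<in> {u..v} \<Longrightarrow> - g w - - g (f x) \<le> D * \<bar>w - f x\<bar>"
      using convex_on_Icc_upper_Lipschitz_at[OF ng] by blast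
    have fx: "(f \<longlongrightarrow> f x) (at x within {a..b})"
      using f x by (simp add: continuous_on_def)
    have up: "((\<lambda>y. g (f x) + C * \<bar>y - x\<bar>) \<longlongrightarrow> g (f x)) (at x within {a..b})"
      by (auto intro!: tendsto_eq_intros)
    have low: "((\<lambda>y. g (f x) - D * \<bar>f y - f x\<bar>) \<longlongrightarrow> g (f x)) (at x within {a..b})"
      by (auto intro!: tendsto_eq_intros fx)
    have "g (f x) - D * \<bar>f y - f x\<bar> \<le> (g \<circ> f) y \<and> (g \<circ> f) y \<le> g (f x) + C * \<bar>y - x\<bar>"
      if "y \<in> {a..b}" for y
    proof -
      have "f y \<in> {u..v}" using that uv by blast
      then show ?thesis using C[OF that] D[of "f y"] by simp
    qed
    then have "\<forall>\<^sub>F y in at x within {a..b}. g (f x) - D * \<bar>f y - f x\<bar> \<le> (g \<circ> f) y"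
      "\<forall>\<^sub>F y in at x within {a..b}. (g \<circ> f) y \<le> g (f x) + C * \<bar>y - x\<bar>"
      by (auto simp: eventually_at_filter)
    then show "((g \<circ> f) \<longlongrightarrow> (g \<circ> f) x) (at x within {a..b})"
      using tendsto_sandwich[OF _ _ low up] by simp
  qed
qed simp

lemma has_integral_reflect_Icc:
  fixes f :: "real \<Rightarrow> 'a::banach"
  assumes "(f has_integral i) {a..b}"
  shows "((\<lambda>z. f (a + b - z)) has_integral i) {a..b}"
proof -
  have "(\<lambda>x. (a + b) - x) ` {a..b} = {a..b}"
    by simp
  then show ?thesis
    using has_integral_affinity[of f i a b "-1" "a + b"] assms by (simp add: algebra_simps)
qed

text \<open>Averaging \<open>f\<close> with its reflection keeps the integral, and the midpoint of
  \<open>z\<close> and \<open>a + b - z\<close> is always \<open>(a + b) / 2\<close>, so the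
  inequality holds pointwise before integration.\<close>

lemma convex_on_midpoint_le_integral:
  fixes f :: "real \<Rightarrow> real"
  assumes "convex_on {a..b} f" "f integrable_on {a..b}" "a \<le> b"
  shows "(b - a) * f ((a + b) / 2) \<le> integral {a..b} f"
proof -
  let ?I = "integral {a..b} f"
  have f: "(f has_integral ?I) {a..b}"
    using assms(2) by (rule integrable_integral)
  then have r: "((\<lambda>z. f (a + b - z)) has_integral ?I) {a..b}"
    by (rule has_integral_reflect_Icc)
  have "((\<lambda>z. f ((a + b) / 2)) has_integral (b - a) * f ((a + b) / 2)) {a..b}"
    using has_integral_const_real[of "f ((a + b) / 2)" a b] assms(3) by simp
  moreover have "((\<lambda>z. (f z + f (a + b - z)) / 2) has_integral (?I + ?I) / 2) {a..b}"
    using has_integral_divide[OF has_integral_add[OF f r], of 2] .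
  moreover have "f ((a + b) / 2) \<le> (f z + f (a + b - z)) / 2" if "z \<in> {a..b}" for z
    using convex_onD[OF assms(1), of "1/2" z "a + b - z"] that by (simp add: field_simps)
  ultimately have "(b - a) * f ((a + b) / 2) \<le> (?I + ?I) / 2"
    by (rule has_integral_le)
  then show ?thesis by simp
qed

lemma convex_on_integral_le_trapezoid:
  fixes f :: "real \<Rightarrow> real"
  assumes "convex_on {a..b} f" "f integrable_on {a..b}" "a \<le> b"
  shows "integral {a..b} f \<le> (b - a) * (f a + f b) / 2"
proof -
  let ?I = "integral {a..b} f"
  have f: "(f has_integral ?I) {a..b}"
    using assms(2) by (rule integrable_integral)
  then have r: "((\<lambda>z. f (a + b - z)) has_integral ?I) {a..b}"
    by (rule has_integral_reflect_Icc)
  have "((\<lambda>z. (f z + f (a + b - z)) / 2) has_integral (?I + ?I) / 2) {a..b}"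
    using has_integral_divide[OF has_integral_add[OF f r], of 2] .
  moreover have "((\<lambda>z. (f a + f b) / 2) has_integral (b - a) * ((f a + f b) / 2)) {a..b}"
    using has_integral_const_real[of "(f a + f b) / 2" a b] assms(3) by simp
  \<comment> \<open>The chord bounds at \<open>z\<close> and at \<open>a + b - z\<close>, based at
    \<open>a\<close> and at \<open>b\<close>, have opposite slopes and the same increment
    \<open>z - a\<close>, so the linear terms cancel in the sum.\<close>
  moreover have "(f z + f (a + b - z)) / 2 \<le> (f a + f b) / 2" if "z \<in> {a..b}" for z
    using convex_onD_Icc'[OF assms(1) that] convex_onD_Icc''[OF assms(1), of "a + b - z"] that
    by (simp add: field_simps diff_divide_distrib)
  ultimately have "(?I + ?I) / 2 \<le> (b - a) * ((f a + f b) / 2)"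
    by (rule has_integral_le)
  then show ?thesis by simp
qed

theorem theorem2p1:
  fixes f g h :: "real \<Rightarrow> real" and J J\<^sub>2 J\<^sub>3 :: "real set" and a b :: real
  assumes "g_convex_on J J\<^sub>2 J\<^sub>3 g f"
    and "h = g \<circ> f"
    and "a \<in> J" and "b \<in> J" and "a < b"
  shows "f ((a + b) / 2) \<le> 1 / (b - a) * integral {a..b} f
    \<and> 1 / (b - a) * integral {a..b} f
        \<le> 1 / (b - a) * integral {a..b}
            (\<lambda>z. inv_into J\<^sub>2 g ((z - a) / (b - a) * h a + (b - z) / (b - a) * h b))
    \<and> 1 / (b - a) * integral {a..b}
            (\<lambda>z. inv_into J\<^sub>2 g ((z - a) / (b - a) * h a + (b - z) / (b - a) * h b))
        \<le> (f a + f b) / 2"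
proof -
  define L where "L = (\<lambda>z. (z - a) / (b - a) * h a + (b - z) / (b - a) * h b)"
  define k where "k = (\<lambda>z. inv_into J\<^sub>2 g (L z))"
  have "{a..b} \<subseteq> J"
    using assms(1,3,4) unfolding g_convex_on_def is_interval_1 by (meson atLeastAtMost_iff subsetI)
  with assms(1) have contf: "continuous_on {a..b} f" and fJ2: "f ` {a..b} \<subseteq> J\<^sub>2"
    and sm: "strict_mono_on J\<^sub>2 g" and cc: "concave_on J\<^sub>2 g" and cvx: "convex_on {a..b} (g \<circ> f)"
    by (auto simp: g_convex_on_def intro: continuous_on_subset convex_on_subset)
  \<comment> \<open>Concavity passes only to convex subsets, so the image must be seen to be an
    interval.\<close>
  have "convex (f ` {a..b})"
    using connected_continuous_image[OF contf] by (simp flip: is_interval_convex_1 is_interval_connected_1)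
  then have "concave_on (f ` {a..b}) g"
    using cc fJ2 convex_on_subset unfolding concave_on_def by blast
  then have conth: "continuous_on {a..b} h"
    using continuous_on_convex_comp_concave[OF contf _ cvx] assms(2) by simp
  \<comment> \<open>This form shows the slope: \<open>L\<close> runs from \<open>h b\<close> to
    \<open>h a\<close>, and the sign of \<open>h a - h b\<close> decides its monotonicity.\<close>
  have L_alt: "L z = h b + (z - a) / (b - a) * (h a - h b)" for z
  proof -
    have "(b - z) / (b - a) = 1 - (z - a) / (b - a)"
      using assms(5) by (simp add: field_simps)
    then show ?thesis
      unfolding L_def by (simp only: left_diff_distrib right_diff_distrib mult_1)
  qed
  \<comment> \<open>Here \<open>inv_into\<close> is shown to pick a true preimage:
    \<open>L z\<close> lies between \<open>h b\<close> and \<open>h a\<close>, hence is a value of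
    the continuous \<open>h\<close> and so of \<open>g\<close> on \<open>J\<^sub>2\<close>.\<close>
  have k: "k z \<in> J\<^sub>2 \<and> g (k z) = L z" if "z \<in> {a..b}" for z
  proof -
    define t where "t = (z - a) / (b - a)"
    have t: "0 \<le> t" "t \<le> 1" using that assms(5) by (auto simp: t_def)
    have "L z \<in> closed_segment (h b) (h a)"
      unfolding in_segment using t by (intro exI[of _ t]) (simp add: L_alt t_def[symmetric] algebra_simps)
    moreover have "connected (h ` {a..b})"
      using connected_continuous_image[OF conth] by simp
    then have "convex (h ` {a..b})" by (simp flip: is_interval_convex_1 is_interval_connected_1)
    then have "closed_segment (h b) (h a) \<subseteq> h ` {a..b}"
      using assms(5) by (intro closed_segment_subset) auto
    ultimately have "L z \<in> g ` J\<^sub>2" using fJ2 assms(2) by auto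
    then show ?thesis unfolding k_def by (simp add: inv_into_into f_inv_into_f)
  qed
  have g_le: "x \<le> y" if "x \<in> J\<^sub>2" "y \<in> J\<^sub>2" "g x \<le> g y" for x y
    using strict_mono_onD[OF sm that(2,1)] that(3) by linarith
  have convf: "convex_on {a..b} f"
    using convex_on_of_convex_comp[OF sm cc fJ2 cvx] .
  have convk: "convex_on {a..b} k"
  proof (rule convex_on_of_convex_comp[OF sm cc])
    show "k ` {a..b} \<subseteq> J\<^sub>2" using k by blast
    show "convex_on {a..b} (g \<circ> k)"
    proof (rule convex_onI)
      fix t x y assume t: "0 < t" "t < (1::real)" and xy: "x \<in> {a..b}" "y \<in> {a..b}"
      have "(1 - t) *\<^sub>R x + t *\<^sub>R y \<in> {a..b}"
        using convexD_alt[OF convex_real_interval(5) xy, of t] t by simp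
      moreover have "L ((1 - t) *\<^sub>R x + t *\<^sub>R y) = (1 - t) * L x + t * L y"
        by (simp add: L_alt algebra_simps add_divide_distrib diff_divide_distrib)
      ultimately show "(g \<circ> k) ((1 - t) *\<^sub>R x + t *\<^sub>R y) \<le> (1 - t) * (g \<circ> k) x + t * (g \<circ> k) y"
        using k xy by simp
    qed simp
  qed
  have intf: "f integrable_on {a..b}"
    using contf by (rule integrable_continuous_real)
  \<comment> \<open>As \<open>g\<close> is strictly increasing, \<open>k\<close> varies in the same
    direction as \<open>L\<close>; integrability then follows from monotonicity alone.\<close>
  have intk: "k integrable_on {a..b}"
  proof (cases "h a \<le> h b")
    case True
    have "mono_on {a..b} (\<lambda>z. - k z)"
    proof (rule mono_onI)
      fix x y assume xy: "x \<in> {a..b}" "y \<in> {a..b}" "x \<le> y"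
      have "L y \<le> L x"
        using xy True assms(5) by (auto simp: L_alt intro!: mult_right_mono_neg divide_right_mono)
      then show "- k x \<le> - k y" using g_le k xy by simp
    qed
    then have "(\<lambda>z. - k z) integrable_on {a..b}" by (rule integrable_on_mono_on)
    then show ?thesis by (simp add: integrable_neg_iff)
  next
    case False
    have "mono_on {a..b} k"
    proof (rule mono_onI)
      fix x y assume xy: "x \<in> {a..b}" "y \<in> {a..b}" "x \<le> y"
      have "L x \<le> L y"
        using xy False assms(5) by (auto simp: L_alt intro!: mult_right_mono divide_right_mono)
      then show "k x \<le> k y" using g_le k xy by simp
    qed
    then show ?thesis by (rule integrable_on_mono_on)
  qed
  \<comment> \<open>The weights in \<open>L\<close> attach \<open>h b\<close> to \<open>a\<close>
    and \<open>h a\<close> to \<open>b\<close>, so \<open>k\<close> exchanges the end values of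
    \<open>f\<close>.\<close>
  have ends: "k a = f b" "k b = f a"
    using inv_into_f_f[OF strict_mono_on_imp_inj_on[OF sm]] fJ2 assms(2,5)
    by (simp_all add: k_def L_def image_subset_iff)
  \<comment> \<open>\<open>L (a + b - z)\<close> is the value at \<open>z\<close> of the chord of
    \<open>h\<close> over \<open>{a..b}\<close>, which dominates \<open>h z\<close>. The reflection
    does not affect the integral of \<open>k\<close>.\<close>
  have "f z \<le> k (a + b - z)" if z: "z \<in> {a..b}" for z
  proof (rule g_le)
    have z': "a + b - z \<in> {a..b}" using z by auto
    show "f z \<in> J\<^sub>2" "k (a + b - z) \<in> J\<^sub>2" using fJ2 z k[OF z'] by auto
    have "h z \<le> L (a + b - z)"
      using convex_onD_Icc''[OF cvx z] assms(2) by (simp add: L_alt mult.commute)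
    then show "g (f z) \<le> g (k (a + b - z))" using k[OF z'] assms(2) by simp
  qed
  moreover have "(f has_integral integral {a..b} f) {a..b}"
    "((\<lambda>z. k (a + b - z)) has_integral integral {a..b} k) {a..b}"
    using integrable_integral[OF intf] has_integral_reflect_Icc[OF integrable_integral[OF intk]]
    by simp_all
  ultimately have "integral {a..b} f \<le> integral {a..b} k"
    by (auto intro: has_integral_le)
  moreover have "(b - a) * f ((a + b) / 2) \<le> integral {a..b} f"
    using convex_on_midpoint_le_integral[OF convf intf] assms(5) by simp
  moreover have "integral {a..b} k \<le> (b - a) * (f a + f b) / 2"
    using convex_on_integral_le_trapezoid[OF convk intk] assms(5) ends by (simp add: add.commute)
  ultimately show ?thesis
    unfolding k_def[unfolded L_def, symmetric] using assms(5)
    by (simp add: pos_le_divide_eq pos_divide_le_eq divide_right_mono mult.commute)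
qed

end
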